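(* We have \[ \begin{aligned} \Psi(P_n^{k,(1),*})-\Psi(P_0) &=\Psi(\tilde P_n^{(1)}\circ\cdots\circ\tilde P_n^{(k)}(P_n^0))-\Psi(P_0)\\ &=\sum_{j=1}^{k}\Big\{(\tilde P_n-P_0)D^{(j)}_{n,\tilde P_n^{(j)}(P_0)}+R_n^{(j)}(\tilde P_n^{(j)}(P_0),P_0)\Big\}\\ &\quad+R_n^{(k)}(\tilde P_n^{(k)}(P_n^0),\tilde P_n)-R_n^{(k)}(\tilde P_n^{(k)}(P_0),\tilde P_n)\\ &\quad-\sum_{j=1}^{k}\tilde P_nD^{(j)}_{n,\tilde P_n^{(j)}(P_0)} . \end{aligned} \] For example, if we use a $k$-th order TMLE that satisfies $\tilde P_nD^{(j)}_{n,\tilde P_n^{(j)}(P_0)}=0$ exactly for $j=1,\dots,k$, then \[ \begin{aligned} \Psi(P_n^{k,(1),*})-\Psi(P_0)&=(P_n-P_0)D^{(1)}_{\tilde P_n^{(1)}(P_0)}+R^{(1)}(\tilde P_n^{(1)}(P_0),P_0)\\ &\quad+\sum_{j=2}^{k}\Big\{(\tilde P_n-P_0)D^{(j)}_{n,\tilde P_n^{(j)}(P_0)}+R_n^{(j)}(\tilde P_n^{(j)}(P_0),P_0)\Big\}\\ &\quad+R_n^{(k)}(\tilde P_n^{(k)}(P_n^0),\tilde P_n)-R_n^{(k)}(\tilde P_n^{(k)}(P_0),\tilde P_n)\\ &\quad+(\tilde P_n-P_n)D^{(1)}_{\tilde P_n^{(1)}(P_0)}, \end{aligned} \] and \[ R_n^{(k)}(\tilde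 P_n^{(k)}(P),\tilde P_n)=R^{(1)}(\tilde P_n^{(1)}\cdots\tilde P_n^{(k)}(P),\tilde P_n). \]
   Context: $O_1,\dots,O_n$ are i.i.d. from $P_0\in{\cal M}$, where the model ${\cal M}$ is a set of probability distributions dominated by a measure $\mu$ (densities $p=dP/d\mu$). $P_n$ is the empirical measure; $Pf=\int f\,dP$ for a (signed) measure $P$. $L(P)=-\log p$. A functional $\Phi:{\cal M}\to\mathbb R$ is pathwise differentiable at $P$ with canonical gradient $D_P$ if for every path $\{P_{\delta,h}\}\subset{\cal M}$ in a given class, through $P$ at $\delta=0$ with score $h$, $\frac{d}{d\delta}\Phi(P_{\delta,h})|_{\delta=0}=P D_Ph$, with $D_P$ in the tangent space $T_P({\cal M})\subset L^2_0(P)$ (closure of the linear span of the scores). $\Psi:{\cal M}\to\mathbb R$ is pathwise differentiable with canonical gradient $D^{(1)}_P$. $\tilde P_n\in{\cal M}$ is the HAL-MLE: a data-dependent maximum likelihood estimator of $P_0$ over the elements of ${\cal M}$ for which the cadlag function parametrizing the density has variation norm bounded by a constant; $d\tilde P_n/dP$ exists at all $P$ used. Recursively, put $\Psi_n^{(0)}=\Psi$, $D^{(1)}_{n,P}=D^{(1)}_P$. For $j\ge1$: $D^{(j)}_{n,P}$ is the canonical gradient of $\Psi_n^{(j-1)}$ at $P$; $\{\tilde P_n^{(j)}(P,\epsilon):\epsilon\}\subset{\cal M}$ is a least favorable path through $P$ at $\epsilon=0$ whose scores at $\epsilon=0$ span $D^{(j)}_{n,P}$; $\epsilon_n^{(j)}(P)$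 is either $\arg\min_\epsilon\tilde P_nL(\tilde P_n^{(j)}(P,\epsilon))$ or a solution of $\tilde P_nD^{(j)}_{n,\tilde P_n^{(j)}(P,\epsilon)}=0$; $\tilde P_n^{(j)}(P)=\tilde P_n^{(j)}(P,\epsilon_n^{(j)}(P))$ is the HAL-regularized TMLE (targeted maximum likelihood estimator) update of $P$, tailored to solve $\tilde P_nD^{(j)}_{n,\tilde P_n^{(j)}(P)}\approx0$ at user-supplied precision at $P=P_0$ and at the successive updates of the initial estimator; and $\Psi_n^{(j)}(P)=\Psi_n^{(j-1)}(\tilde P_n^{(j)}(P))$. The HAL-MLE is a fixed point of the updates: $\tilde P_n^{(j)}(\tilde P_n)=\tilde P_n$. The exact remainder is $R_n^{(j)}(P,P')=\Psi_n^{(j-1)}(P)-\Psi_n^{(j-1)}(P')+P'D^{(j)}_{n,P}$, and $R^{(1)}=R_n^{(1)}$. Juxtaposition of update maps denotes composition; $P$ denotes an element of ${\cal M}$. $P_n^0\in{\cal M}$ is an initial estimator, $k\ge1$, and $P_n^{k,(1),*}=\tilde P_n^{(1)}\circ\cdots\circ\tilde P_n^{(k)}(P_n^0)$ is the HAL-regularized $k$-th order TMLE.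
   Formalization: Display 1 needs equal P̃_nD^(k) at the k-th updates of P_n^0 and P_0 (else error ≤ 2·precision); display 2 also needs P̃_nD^(k)=0 at the k-th update of P_n^0; display 3 needs P̃_nD^(k) at P̃^(k)(P) to equal P̃_nD^(1) at the full update of P. As printed they fail if scores are only ≈0. *)

theory Defs
  imports "HOL-Probability.Probability"
begin

text \<open>A distribution is a measure on the sigma-algebra of the dominating measure \<open>\<mu>\<close>. A signed
  measure \<open>P - Q\<close> enters only through its action on functions.\<close>

definition diff_int :: "'o measure \<Rightarrow> 'o measure \<Rightarrow> ('o \<Rightarrow> real) \<Rightarrow> real" where
  "diff_int P Q f = (\<integral>x. f x \<partial>P) - (\<integral>x. f x \<partial>Q)"

definition empirical :: "'o measure \<Rightarrow> nat \<Rightarrow> (nat \<Rightarrow> 'o) \<Rightarrow> 'o measure" where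
  "empirical \<mu> n x = distr (uniform_count_measure {1..n}) \<mu> x"


text \<open>Cadlag functions on the cube \<open>cbox 0 \<tau>\<close>: limits exist from all \<open>2^d\<close> quadrants at each point,
  and the function is continuous from the closed upper quadrant. The quadrant \<open>a\<close> approaches the
  point from above in the coordinates in \<open>a\<close> and strictly from below in the others.\<close>

definition quadrant :: "real^'d \<Rightarrow> 'd set \<Rightarrow> real^'d \<Rightarrow> (real^'d) set" where
  "quadrant \<tau> a u = {v \<in> cbox 0 \<tau>. \<forall>i. if i \<in> a then v $ i \<ge> u $ i else v $ i < u $ i}"

definition cadlag_on_cube :: "real^'d \<Rightarrow> (real^'d \<Rightarrow> real) \<Rightarrow> bool" where
  "cadlag_on_cube \<tau> f \<longleftrightarrow>
     (\<forall>u\<in>cbox 0 \<tau>. (\<forall>a. \<exists>l. (f \<longlongrightarrow> l) (at u within quadrant \<tau> a u)) \<and>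
        (f \<longlongrightarrow> f u) (at u within quadrant \<tau> UNIV u))"

text \<open>Variation norm \<open>\<bar>f 0\<bar> + (\<Sum>s\<noteq>{}. \<integral> \<bar>df\<^sub>s\<bar>)\<close>, where the section \<open>f\<^sub>s\<close> sets the coordinates outside
  \<open>s\<close> to \<open>0\<close>. The total variation of \<open>f\<^sub>s\<close> is the supremum, over product grids
  \<open>0 = t i 0 \<le> \<dots> \<le> t i m = \<tau> i\<close>, of the sum over the grid cells \<open>c\<close> of the absolute alternating
  vertex sums of \<open>f\<close>. For \<open>s = {}\<close> there is a single cell and a single vertex, \<open>0\<close>, and the
  value is \<open>\<bar>f 0\<bar>\<close>.\<close>

definition cell_increment ::
    "'d set \<Rightarrow> ('d \<Rightarrow> nat \<Rightarrow> real) \<Rightarrow> (real^'d \<Rightarrow> real) \<Rightarrow> ('d \<Rightarrow> nat) \<Rightarrow> real" where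
  "cell_increment s t f c =
     (\<Sum>e\<in>Pow s. (-1) ^ card (s - e) *
        f (\<chi> i. if i \<in> e then t i (Suc (c i)) else if i \<in> s then t i (c i) else 0))"

definition section_variation :: "real^'d \<Rightarrow> 'd set \<Rightarrow> (real^'d \<Rightarrow> real) \<Rightarrow> ennreal" where
  "section_variation \<tau> s f =
     (SUP (m, t) \<in> {(m, t). \<forall>i. t i 0 = 0 \<and> t i m = \<tau> $ i \<and> mono_on {..m} (t i)}.
        ennreal (\<Sum>c\<in>(\<Pi>\<^sub>E i\<in>s. {..<m}). \<bar>cell_increment s t f c\<bar>))"

definition variation_norm :: "real^'d \<Rightarrow> (real^'d \<Rightarrow> real) \<Rightarrow> ennreal" where
  "variation_norm \<tau> f = (\<Sum>s\<in>UNIV. section_variation \<tau> s f)"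


text \<open>The density of \<open>P \<in> M\<close> is parametrized by the cadlag function \<open>par P\<close>, as \<open>dens (par P)\<close>.
  The densities are fixed versions, because they are evaluated at the observations. Below,
  \<open>p P\<close> stands for \<open>dens (par P)\<close>.\<close>

definition statistical_model ::
    "'o measure \<Rightarrow> real^'d \<Rightarrow> ((real^'d \<Rightarrow> real) \<Rightarrow> 'o \<Rightarrow> real) \<Rightarrow>
     ('o measure \<Rightarrow> real^'d \<Rightarrow> real) \<Rightarrow> 'o measure set \<Rightarrow> bool" where
  "statistical_model \<mu> \<tau> dens par M \<longleftrightarrow> (\<forall>i. \<tau> $ i > 0) \<and>
     (\<forall>P\<in>M. prob_space P \<and> cadlag_on_cube \<tau> (par P) \<and>
        dens (par P) \<in> borel_measurable \<mu> \<and> (\<forall>x\<in>space \<mu>. dens (par P) x \<ge> 0) \<and>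
        P = density \<mu> (\<lambda>x. ennreal (dens (par P) x)))"

text \<open>The loss \<open>- log p\<close> is \<open>\<infinity>\<close> where the density vanishes (\<open>ln 0 = 0\<close> in the library). The integral
  of an extended real function is the difference of the integrals of its positive and negative
  parts; an undefined \<open>\<infinity> - \<infinity>\<close> evaluates to \<open>\<infinity>\<close> and hence never helps to minimize a risk.\<close>

definition loss :: "('o measure \<Rightarrow> 'o \<Rightarrow> real) \<Rightarrow> 'o measure \<Rightarrow> 'o \<Rightarrow> ereal" where
  "loss p P x = (if p P x > 0 then ereal (- ln (p P x)) else \<infinity>)"

definition risk :: "('o measure \<Rightarrow> 'o \<Rightarrow> real) \<Rightarrow> 'o measure \<Rightarrow> 'o measure \<Rightarrow> ereal" where
  "risk p Q P = enn2ereal (\<integral>\<^sup>+x. e2ennreal (loss p P x) \<partial>Q)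
              - enn2ereal (\<integral>\<^sup>+x. e2ennreal (- loss p P x) \<partial>Q)"

definition hal_mle ::
    "('o measure \<Rightarrow> 'o \<Rightarrow> real) \<Rightarrow> ('o measure \<Rightarrow> real^'d \<Rightarrow> real) \<Rightarrow> real^'d \<Rightarrow> real \<Rightarrow>
     'o measure set \<Rightarrow> 'o measure \<Rightarrow> 'o measure \<Rightarrow> bool" where
  "hal_mle p par \<tau> C M Pn Pt \<longleftrightarrow>
     Pt \<in> M \<and> variation_norm \<tau> (par Pt) \<le> ennreal C \<and>
     (\<forall>P\<in>M. variation_norm \<tau> (par P) \<le> ennreal C \<longrightarrow> risk p Pn Pt \<le> risk p Pn P)"


definition L20 :: "'o measure \<Rightarrow> ('o \<Rightarrow> real) set" where
  "L20 P = {f \<in> borel_measurable P. integrable P (\<lambda>x. (f x)\<^sup>2) \<and> (\<integral>x. f x \<partial>P) = 0}"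

definition path_with_score ::
    "('o measure \<Rightarrow> 'o \<Rightarrow> real) \<Rightarrow> 'o measure set \<Rightarrow> 'o measure \<Rightarrow>
     (real \<Rightarrow> 'o measure) \<Rightarrow> ('o \<Rightarrow> real) \<Rightarrow> bool" where
  "path_with_score p M P \<gamma> h \<longleftrightarrow>
     \<gamma> 0 = P \<and> (\<forall>\<^sub>F \<delta> in nhds 0. \<gamma> \<delta> \<in> M) \<and> h \<in> L20 P \<and>
     (AE x in P. (\<forall>\<^sub>F \<delta> in nhds 0. p (\<gamma> \<delta>) x > 0) \<and>
        ((\<lambda>\<delta>. ln (p (\<gamma> \<delta>) x)) has_real_derivative h x) (at 0))"

text \<open>\<open>Cls P\<close> is the given class of paths through \<open>P\<close>, each paired with its score.\<close>

definition path_class ::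
    "('o measure \<Rightarrow> 'o \<Rightarrow> real) \<Rightarrow> 'o measure set \<Rightarrow>
     ('o measure \<Rightarrow> ((real \<Rightarrow> 'o measure) \<times> ('o \<Rightarrow> real)) set) \<Rightarrow> bool" where
  "path_class p M Cls \<longleftrightarrow> (\<forall>P\<in>M. \<forall>(\<gamma>, h)\<in>Cls P. path_with_score p M P \<gamma> h)"

definition lin_span :: "('o \<Rightarrow> real) set \<Rightarrow> ('o \<Rightarrow> real) set" where
  "lin_span S = {(\<lambda>x. \<Sum>h\<in>F. c h * h x) | c F. finite F \<and> F \<subseteq> S}"

definition tangent_space :: "'o measure \<Rightarrow> ('o \<Rightarrow> real) set \<Rightarrow> ('o \<Rightarrow> real) set" where
  "tangent_space P S =
     {g \<in> L20 P. \<forall>e>0. \<exists>f\<in>lin_span S. (\<integral>x. (g x - f x)\<^sup>2 \<partial>P) < e}"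

definition canonical_gradient ::
    "('o measure \<Rightarrow> ((real \<Rightarrow> 'o measure) \<times> ('o \<Rightarrow> real)) set) \<Rightarrow>
     ('o measure \<Rightarrow> real) \<Rightarrow> 'o measure \<Rightarrow> ('o \<Rightarrow> real) \<Rightarrow> bool" where
  "canonical_gradient Cls \<Phi> P g \<longleftrightarrow>
     g \<in> tangent_space P (snd ` Cls P) \<and>
     (\<forall>(\<gamma>, h)\<in>Cls P. ((\<lambda>\<delta>. \<Phi> (\<gamma> \<delta>)) has_real_derivative (\<integral>x. g x * h x \<partial>P)) (at 0))"

text \<open>A path in a parameter \<open>\<epsilon>\<close> of any finite dimension; the scores are those of the coordinate
  paths, and \<open>g\<close> lies in their linear span.\<close>

definition least_favorable_path ::
    "('o measure \<Rightarrow> 'o \<Rightarrow> real) \<Rightarrow> 'o measure set \<Rightarrow> 'o measure \<Rightarrow>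
     'e::euclidean_space set \<Rightarrow> ('e \<Rightarrow> 'o measure) \<Rightarrow> ('o \<Rightarrow> real) \<Rightarrow> bool" where
  "least_favorable_path p M P E \<gamma> g \<longleftrightarrow>
     0 \<in> interior E \<and> \<gamma> 0 = P \<and> (\<forall>\<epsilon>\<in>E. \<gamma> \<epsilon> \<in> M) \<and>
     (\<exists>S. (\<forall>b\<in>Basis. path_with_score p M P (\<lambda>\<delta>. \<gamma> (\<delta> *\<^sub>R b)) (S b)) \<and>
        (\<exists>c. AE x in P. g x = (\<Sum>b\<in>Basis. c b * S b x)))"

text \<open>The two admissible choices of \<open>\<epsilon>\<close>; \<open>D\<close> maps a distribution to the gradient there.\<close>

definition targeting_step ::
    "('o measure \<Rightarrow> 'o \<Rightarrow> real) \<Rightarrow> 'o measure \<Rightarrow> ('o measure \<Rightarrow> 'o \<Rightarrow> real) \<Rightarrow>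
     'e set \<Rightarrow> ('e \<Rightarrow> 'o measure) \<Rightarrow> 'e \<Rightarrow> bool" where
  "targeting_step p Pt D E \<gamma> e \<longleftrightarrow> e \<in> E \<and>
     ((\<forall>\<epsilon>\<in>E. risk p Pt (\<gamma> e) \<le> risk p Pt (\<gamma> \<epsilon>)) \<or> (\<integral>x. D (\<gamma> e) x \<partial>Pt) = 0)"


primrec Psi_n ::
    "('o measure \<Rightarrow> real) \<Rightarrow> (nat \<Rightarrow> 'o measure \<Rightarrow> 'o measure) \<Rightarrow> nat \<Rightarrow> 'o measure \<Rightarrow> real" where
  "Psi_n \<Psi> T 0 = \<Psi>"
| "Psi_n \<Psi> T (Suc j) = (\<lambda>P. Psi_n \<Psi> T j (T (Suc j) P))"

definition exact_remainder ::
    "('o measure \<Rightarrow> real) \<Rightarrow> ('o measure \<Rightarrow> 'o \<Rightarrow> real) \<Rightarrow> 'o measure \<Rightarrow> 'o measure \<Rightarrow> real" where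
  "exact_remainder \<Phi> D P P' = \<Phi> P - \<Phi> P' + (\<integral>x. D P x \<partial>P')"

definition R_n ::
    "('o measure \<Rightarrow> real) \<Rightarrow> (nat \<Rightarrow> 'o measure \<Rightarrow> 'o measure) \<Rightarrow>
     (nat \<Rightarrow> 'o measure \<Rightarrow> 'o \<Rightarrow> real) \<Rightarrow> nat \<Rightarrow> 'o measure \<Rightarrow> 'o measure \<Rightarrow> real" where
  "R_n \<Psi> T D j = exact_remainder (Psi_n \<Psi> T (j - 1)) (D j)"

text \<open>\<open>T i \<circ> T (i + 1) \<circ> \<dots> \<circ> T k\<close>, which is the identity if \<open>i > k\<close>.\<close>

definition compose_updates ::
    "(nat \<Rightarrow> 'o measure \<Rightarrow> 'o measure) \<Rightarrow> nat \<Rightarrow> nat \<Rightarrow> 'o measure \<Rightarrow> 'o measure" where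
  "compose_updates T i k = foldr (\<circ>) (map T [i..<Suc k]) id"

end

theory Submission
  imports Defs
begin

text \<open>Write \<open>\<Psi>\<^sub>j\<close> for \<open>Psi_n \<Psi> T j\<close>. The expansion is a telescoping identity, exact up to one explicit
  term. By the definition of the remainder and \<open>\<Psi>\<^sub>j Q = \<Psi>\<^sub>j\<^sub>-\<^sub>1 (T j Q)\<close>,
  \<open>R\<^sub>j (T j P, P') = \<Psi>\<^sub>j P - \<Psi>\<^sub>j\<^sub>-\<^sub>1 P' + P' D\<^sub>j (T j P)\<close> for all \<open>P\<close> and \<open>P'\<close>
  (\<open>R_n_at_update\<close>). This identity is used at two second arguments.

  At \<open>P = P' = P0\<close>, the term \<open>P0 D\<^sub>j (T j P0)\<close> cancels against the one in \<open>(Pt - P0) D\<^sub>j (T j P0)\<close>,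
  so that the \<open>j\<close>-th summand minus \<open>Pt D\<^sub>j (T j P0)\<close> equals \<open>\<Psi>\<^sub>j P0 - \<Psi>\<^sub>j\<^sub>-\<^sub>1 P0\<close>. Summing over \<open>j\<close> gives
  \<open>\<Psi>\<^sub>k P0 - \<Psi> P0\<close> (\<open>telescope_along_updates\<close>), the effect of updating the truth itself. What is
  left is \<open>\<Psi>\<^sub>k Pn0 - \<Psi>\<^sub>k P0\<close>. At \<open>P' = Pt\<close>, it is the difference of the two \<open>k\<close>-th
  remainders, up to \<open>Pt D\<^sub>k (T k Pn0) - Pt D\<^sub>k (T k P0)\<close>. The updates solve their score equations only
  approximately, so this last term is the error of the expansion (\<open>expansion_with_score_error\<close>): it
  vanishes if the two scores agree and is bounded by twice the precision of step \<open>k\<close>.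

  The \<open>k\<close>-th remainder becomes a first-order one because \<open>\<Psi>\<^sub>k\<close> is \<open>\<Psi>\<close> after all \<open>k\<close> updates
  (\<open>Psi_n_eq_compose_updates\<close>), whereas \<open>\<Psi>\<^sub>k\<^sub>-\<^sub>1 Pt = \<Psi> Pt\<close> since \<open>Pt\<close> is a fixed point. Again the two
  sides differ only in the scores (\<open>R_n_minus_first_order_remainder\<close>), which the precisions of the
  steps \<open>k\<close> and \<open>1\<close> bound when \<open>P = Pn0\<close>.\<close>

lemma compose_updates_empty [simp]: "compose_updates T (Suc k) k P = P"
  by (simp add: compose_updates_def)

lemma foldr_comp_id: "foldr (\<circ>) fs g = foldr (\<circ>) fs id \<circ> g"
  by (induction fs) (simp_all add: o_assoc)

lemma compose_updates_Suc:
  assumes "i \<le> Suc k"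
  shows "compose_updates T i (Suc k) P = compose_updates T i k (T (Suc k) P)"
proof -
  have "compose_updates T i (Suc k) = foldr (\<circ>) (map T [i..<Suc k]) (T (Suc k))"
    using assms by (simp add: compose_updates_def)
  also have "\<dots> = compose_updates T i k \<circ> T (Suc k)"
    unfolding compose_updates_def by (rule foldr_comp_id)
  finally show ?thesis by simp
qed

lemma compose_updates_Cons:
  assumes "i \<le> k"
  shows "compose_updates T i k P = T i (compose_updates T (Suc i) k P)"
proof -
  have "[i..<Suc k] = i # [Suc i..<Suc k]"
    using assms by (intro upt_conv_Cons) simp
  then show ?thesis by (simp only: compose_updates_def list.map foldr.simps o_apply)
qed

lemma Psi_n_eq_compose_updates: "Psi_n \<Psi> T k P = \<Psi> (compose_updates T 1 k P)"
  by (induction k arbitrary: P) (simp_all add: compose_updates_Suc)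

lemma Psi_n_fixed_point:
  assumes "\<And>j. j \<in> {1..k} \<Longrightarrow> T j Q = Q"
  shows "Psi_n \<Psi> T k Q = \<Psi> Q"
  using assms by (induction k) auto

text \<open>The shift of the index in \<open>\<Psi>\<^sub>j P = \<Psi>\<^sub>j\<^sub>-\<^sub>1 (T j P)\<close> is what makes the remainders of successive
  orders fit together.\<close>

lemma R_n_at_update:
  assumes "j \<ge> 1"
  shows "R_n \<Psi> T D j (T j P) P'
    = Psi_n \<Psi> T j P - Psi_n \<Psi> T (j - 1) P' + (\<integral>x. D j (T j P) x \<partial>P')"
  using assms by (cases j) (simp_all add: R_n_def exact_remainder_def)

text \<open>Each summand on the left is \<open>\<Psi>\<^sub>j P - \<Psi>\<^sub>j\<^sub>-\<^sub>1 P\<close>: the integrals against \<open>Q\<close> and against \<open>P\<close> occur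
  with both signs.\<close>

lemma telescope_along_updates:
  "(\<Sum>j=1..k. diff_int Q P (D j (T j P)) + R_n \<Psi> T D j (T j P) P)
     - (\<Sum>j=1..k. \<integral>x. D j (T j P) x \<partial>Q)
   = Psi_n \<Psi> T k P - \<Psi> P"
proof (induction k)
  case 0
  then show ?case by simp
next
  case (Suc k)
  have "R_n \<Psi> T D (Suc k) (T (Suc k) P) P
    = Psi_n \<Psi> T (Suc k) P - Psi_n \<Psi> T k P + (\<integral>x. D (Suc k) (T (Suc k) P) x \<partial>P)"
    using R_n_at_update[of "Suc k"] by simp
  then show ?case
    using Suc.IH by (simp add: diff_int_def del: Psi_n.simps)
qed

text \<open>The difference of the two \<open>k\<close>-th remainders replaces the starting point \<open>P\<close> of the updates by
  \<open>P'\<close>. The terms \<open>\<Psi>\<^sub>k\<^sub>-\<^sub>1 Q\<close> in them cancel, but the scores of the last step need not.\<close>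

lemma expansion_with_score_error:
  assumes "k \<ge> 1"
  shows "(\<Sum>j=1..k. diff_int Q P (D j (T j P)) + R_n \<Psi> T D j (T j P) P)
     + R_n \<Psi> T D k (T k P') Q - R_n \<Psi> T D k (T k P) Q
     - (\<Sum>j=1..k. \<integral>x. D j (T j P) x \<partial>Q)
   = \<Psi> (compose_updates T 1 k P') - \<Psi> P
     + ((\<integral>x. D k (T k P') x \<partial>Q) - (\<integral>x. D k (T k P) x \<partial>Q))"
  using telescope_along_updates[of Q P D T \<Psi> k]
    R_n_at_update[OF assms, of \<Psi> T D P' Q] R_n_at_update[OF assms, of \<Psi> T D P Q]
  unfolding Psi_n_eq_compose_updates[symmetric] by linarith

text \<open>Both remainders start from \<open>\<Psi>\<close> at the fully updated \<open>P\<close> and subtract the same number, because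
  the updates of orders below \<open>k\<close> leave \<open>Q\<close> in place.\<close>

lemma R_n_minus_first_order_remainder:
  assumes "k \<ge> 1" and "\<And>j. j \<in> {1..k} \<Longrightarrow> T j Q = Q"
  shows "R_n \<Psi> T D k (T k P) Q - exact_remainder \<Psi> D' (compose_updates T 1 k P) Q
    = (\<integral>x. D k (T k P) x \<partial>Q) - (\<integral>x. D' (compose_updates T 1 k P) x \<partial>Q)"
proof -
  have "Psi_n \<Psi> T (k - 1) Q = \<Psi> Q"
    using assms(2) by (intro Psi_n_fixed_point) auto
  then show ?thesis
    using R_n_at_update[OF assms(1), of \<Psi> T D P Q]
    by (simp add: Psi_n_eq_compose_updates exact_remainder_def)
qed

theorem theorem2:
  fixes \<mu> :: "'o measure" and M :: "'o measure set"
    and \<tau> :: "real^'d" and dens :: "(real^'d \<Rightarrow> real) \<Rightarrow> 'o \<Rightarrow> real"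
    and par :: "'o measure \<Rightarrow> real^'d \<Rightarrow> real" and C :: real
    and p :: "'o measure \<Rightarrow> 'o \<Rightarrow> real"
    and \<Omega> :: "'w measure" and X :: "nat \<Rightarrow> 'w \<Rightarrow> 'o" and \<omega> :: 'w and n k :: nat
    and P0 Pn Pt Pn0 Pstar :: "'o measure"
    and Cls :: "'o measure \<Rightarrow> ((real \<Rightarrow> 'o measure) \<times> ('o \<Rightarrow> real)) set"
    and \<Psi> :: "'o measure \<Rightarrow> real" and D1 :: "'o measure \<Rightarrow> 'o \<Rightarrow> real"
    and D :: "nat \<Rightarrow> 'o measure \<Rightarrow> 'o \<Rightarrow> real"
    and E :: "nat \<Rightarrow> 'o measure \<Rightarrow> 'e::euclidean_space set"
    and path :: "nat \<Rightarrow> 'o measure \<Rightarrow> 'e \<Rightarrow> 'o measure"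
    and eps :: "nat \<Rightarrow> 'o measure \<Rightarrow> 'e"
    and T :: "nat \<Rightarrow> 'o measure \<Rightarrow> 'o measure"
    and tol :: "nat \<Rightarrow> real"
  assumes model: "statistical_model \<mu> \<tau> dens par M"
    and p_def: "p = (\<lambda>P. dens (par P))"
    and paths: "path_class p M Cls"
    (* the i.i.d. sample; Pn, Pt, Pn0 and D, E, path, eps, T are values at its realization \<omega> *)
    and sample_space: "prob_space \<Omega>"
    and indep: "prob_space.indep_vars \<Omega> (\<lambda>_. \<mu>) X {1..n}"
    and identical: "\<forall>i\<in>{1..n}. distr \<Omega> \<mu> (X i) = P0"
    and n: "n \<ge> 1" and P0: "P0 \<in> M" and \<omega>: "\<omega> \<in> space \<Omega>"
    and Pn: "Pn = empirical \<mu> n (\<lambda>i. X i \<omega>)"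
    and Pt: "hal_mle p par \<tau> C M Pn Pt"
    and Pn0: "Pn0 \<in> M" and k: "k \<ge> 1"
    and D1: "\<forall>P\<in>M. canonical_gradient Cls \<Psi> P (D1 P)" "D 1 = D1"
    and D: "\<forall>j\<in>{1..k}. \<forall>P\<in>M. absolutely_continuous P Pt \<longrightarrow>
              canonical_gradient Cls (Psi_n \<Psi> T (j - 1)) P (D j P)"
    and lfp: "\<forall>j\<in>{1..k}. \<forall>P\<in>M. absolutely_continuous P Pt \<longrightarrow>
              least_favorable_path p M P (E j P) (path j P) (D j P)"
    and eps: "\<forall>j\<in>{1..k}. \<forall>P\<in>M. absolutely_continuous P Pt \<longrightarrow>
              targeting_step p Pt (D j) (E j P) (path j P) (eps j P)"
    and T: "\<forall>j P. T j P = path j P (eps j P)"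
    and fixed_point: "\<forall>j\<in>{1..k}. T j Pt = Pt"
    and Pstar: "Pstar = compose_updates T 1 k Pn0"
    and abs_cont:
      "\<forall>Q \<in> {P0} \<union> {T j P0 | j. j \<in> {1..k}} \<union> {compose_updates T j k Pn0 | j. j \<in> {1..Suc k}}.
         absolutely_continuous Q Pt"
    and precision: "\<forall>j\<in>{1..k}. \<forall>Q\<in>{P0, compose_updates T (Suc j) k Pn0}.
              \<bar>\<integral>x. D j (T j Q) x \<partial>Pt\<bar> \<le> tol j"
  shows
    "\<Psi> Pstar - \<Psi> P0 = \<Psi> (compose_updates T 1 k Pn0) - \<Psi> P0
     \<and>
     (let rhs = (\<Sum>j=1..k. diff_int Pt P0 (D j (T j P0)) + R_n \<Psi> T D j (T j P0) P0)
              + R_n \<Psi> T D k (T k Pn0) Pt - R_n \<Psi> T D k (T k P0) Pt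
              - (\<Sum>j=1..k. \<integral>x. D j (T j P0) x \<partial>Pt)
      in ((\<integral>x. D k (T k Pn0) x \<partial>Pt) = (\<integral>x. D k (T k P0) x \<partial>Pt) \<longrightarrow>
            \<Psi> (compose_updates T 1 k Pn0) - \<Psi> P0 = rhs) \<and>
         \<bar>\<Psi> (compose_updates T 1 k Pn0) - \<Psi> P0 - rhs\<bar> \<le> 2 * tol k)
     \<and>
     ((\<forall>j\<in>{1..k}. (\<integral>x. D j (T j P0) x \<partial>Pt) = 0) \<and> (\<integral>x. D k (T k Pn0) x \<partial>Pt) = 0 \<longrightarrow>
       \<Psi> Pstar - \<Psi> P0 =
         diff_int Pn P0 (D1 (T 1 P0)) + exact_remainder \<Psi> D1 (T 1 P0) P0
       + (\<Sum>j=2..k. diff_int Pt P0 (D j (T j P0)) + R_n \<Psi> T D j (T j P0) P0)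
       + R_n \<Psi> T D k (T k Pn0) Pt - R_n \<Psi> T D k (T k P0) Pt
       + diff_int Pt Pn (D1 (T 1 P0)))
     \<and>
     (\<forall>P\<in>M. (\<integral>x. D k (T k P) x \<partial>Pt) = (\<integral>x. D1 (compose_updates T 1 k P) x \<partial>Pt) \<longrightarrow>
       R_n \<Psi> T D k (T k P) Pt = exact_remainder \<Psi> D1 (compose_updates T 1 k P) Pt)
     \<and>
     \<bar>R_n \<Psi> T D k (T k Pn0) Pt - exact_remainder \<Psi> D1 (compose_updates T 1 k Pn0) Pt\<bar>
       \<le> tol k + tol 1"
proof -
  define S where "S P = (\<integral>x. D k (T k P) x \<partial>Pt)" for P
  define G where "G j = diff_int Pt P0 (D j (T j P0)) + R_n \<Psi> T D j (T j P0) P0" for j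
  define rhs where "rhs = (\<Sum>j=1..k. G j)
              + R_n \<Psi> T D k (T k Pn0) Pt - R_n \<Psi> T D k (T k P0) Pt
              - (\<Sum>j=1..k. \<integral>x. D j (T j P0) x \<partial>Pt)"
  have expansion: "rhs = \<Psi> (compose_updates T 1 k Pn0) - \<Psi> P0 + (S Pn0 - S P0)"
    unfolding rhs_def G_def S_def by (rule expansion_with_score_error[OF k])
  have remainder: "R_n \<Psi> T D k (T k P) Pt - exact_remainder \<Psi> D1 (compose_updates T 1 k P) Pt
      = S P - (\<integral>x. D1 (compose_updates T 1 k P) x \<partial>Pt)" for P
    unfolding S_def using k fixed_point by (intro R_n_minus_first_order_remainder) auto

  \<comment> \<open>The updates of \<open>Pn0\<close> run from order \<open>k\<close> down to \<open>1\<close>, so step \<open>k\<close> acts on \<open>Pn0\<close> itself and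
    the last step produces the whole composition.\<close>
  have S_P0: "\<bar>S P0\<bar> \<le> tol k" and S_Pn0: "\<bar>S Pn0\<bar> \<le> tol k"
    using bspec[OF precision, of k] k by (simp_all add: S_def)
  have last_score: "\<bar>\<integral>x. D1 (compose_updates T 1 k Pn0) x \<partial>Pt\<bar> \<le> tol 1"
    using precision k D1(2) compose_updates_Cons[OF k, of T Pn0] by auto

  have solved: "\<Psi> Pstar - \<Psi> P0 =
         diff_int Pn P0 (D1 (T 1 P0)) + exact_remainder \<Psi> D1 (T 1 P0) P0
       + (\<Sum>j=2..k. G j)
       + R_n \<Psi> T D k (T k Pn0) Pt - R_n \<Psi> T D k (T k P0) Pt
       + diff_int Pt Pn (D1 (T 1 P0))"
    if zero: "\<forall>j\<in>{1..k}. (\<integral>x. D j (T j P0) x \<partial>Pt) = 0" "S Pn0 = 0"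
  proof -
    have "S P0 = 0"
      using zero(1) k by (simp add: S_def)
    then have "\<Psi> Pstar - \<Psi> P0 = rhs"
      using expansion zero(2) Pstar by simp
    moreover have "(\<Sum>j=1..k. \<integral>x. D j (T j P0) x \<partial>Pt) = 0"
      using zero(1) by simp
    moreover have "(\<Sum>j=1..k. G j) = G 1 + (\<Sum>j=2..k. G j)"
      using sum.atLeast_Suc_atMost[OF k, of G] by (simp add: numeral_2_eq_2)
    \<comment> \<open>The empirical measure enters by splitting \<open>Pt - P0\<close> into \<open>(Pn - P0) + (Pt - Pn)\<close>.\<close>
    moreover have "G 1 = diff_int Pn P0 (D1 (T 1 P0)) + exact_remainder \<Psi> D1 (T 1 P0) P0
        + diff_int Pt Pn (D1 (T 1 P0))"
      using D1(2) by (simp add: G_def R_n_def diff_int_def)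
    ultimately show ?thesis
      unfolding rhs_def by linarith
  qed

  show ?thesis
    unfolding Let_def G_def[symmetric] rhs_def[symmetric] S_def[symmetric]
  proof (intro conjI impI ballI)
    show "\<Psi> Pstar - \<Psi> P0 = \<Psi> (compose_updates T 1 k Pn0) - \<Psi> P0"
      using Pstar by simp
    show "\<Psi> (compose_updates T 1 k Pn0) - \<Psi> P0 = rhs" if "S Pn0 = S P0"
      using expansion that by simp
    show "\<bar>\<Psi> (compose_updates T 1 k Pn0) - \<Psi> P0 - rhs\<bar> \<le> 2 * tol k"
      using expansion S_P0 S_Pn0 by linarith
    show "\<bar>R_n \<Psi> T D k (T k Pn0) Pt - exact_remainder \<Psi> D1 (compose_updates T 1 k Pn0) Pt\<bar>
        \<le> tol k + tol 1"
      using remainder[of Pn0] S_Pn0 last_score by linarith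
  next
    fix P
    assume "S P = (\<integral>x. D1 (compose_updates T 1 k P) x \<partial>Pt)"
    then show "R_n \<Psi> T D k (T k P) Pt = exact_remainder \<Psi> D1 (compose_updates T 1 k P) Pt"
      using remainder[of P] by simp
  qed (use solved in blast)
qed

end
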